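(* Let $\bar x$ be upper-level regular and suppose that $(A_1^m)$ and $(A_2^m)$ hold at $(\bar x,\bar y,\bar u)$ with $(\bar y,\bar u)\in\mathcal{D}(\bar x)$. Then there exist neighborhoods $U$ and $V$ of $\bar x$ and $(\bar y,\bar u)$, respectively, such that for all $t>0$ sufficiently close to $0$, the following two constraint qualifications are satisfied at all points $(x,y,u)$ with $x\in U\cap X$ and $(y,u)\in V\cap\mathcal{D}^t(x)$: (a) for $\alpha\in\mathbb{R}^p$: $\left[\alpha\ge0,\ \alpha^\top G(x)=0,\ \nabla G(x)^\top\alpha=0\right]\Rightarrow\alpha=0$; (b) for $(\beta,\gamma,\delta,\mu)\in\mathbb{R}^m\times\mathbb{R}^q\times\mathbb{R}^q\times\mathbb{R}^q$: if $$\nabla_y\mathcal{L}(x,y,u)^\top\beta-\sum_{i=1}^q(\gamma_i-\delta_iu_i)\nabla_yg_i(x,y)=0,$$ and for all $i=1,\dots,q$, $\nabla_yg_i(x,y)\beta+\mu_i+\delta_ig_i(x,y)=0$, $\gamma_i\ge0$, $\delta_i\ge0$, $\mu_i\ge0$, $\mu_iu_i=0$, $\gamma_ig_i(x,y)=0$ and $\delta_i(u_ig_i(x,y)+t)=0$, then $\beta=0$ and $\delta=\gamma=\mu=0$.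
   Context: Setting. $f:\mathbb{R}^n\times\mathbb{R}^m\to\mathbb{R}$, $G:\mathbb{R}^n\to\mathbb{R}^p$, $g:\mathbb{R}^n\times\mathbb{R}^m\to\mathbb{R}^q$ are twice continuously differentiable. Let $X=\{x\in\mathbb{R}^n: G(x)\le 0\}$ and $S(x)=\arg\min_y\{f(x,y): g(x,y)\le 0\}$. Standing assumptions: $S(x)\neq\varnothing$ if $x\in X$ and $S(x)=\varnothing$ otherwise; $f$ and $g_1,\dots,g_q$ are convex in $y$; Slater condition: for every $x\in X$ there is $y(x)\in\mathbb{R}^m$ with $g_i(x,y(x))<0$ for all $i$. Let $\mathcal{L}(x,y,u)=\nabla_y f(x,y)+\sum_{i=1}^q u_i\nabla_y g_i(x,y)$ and $\mathcal{D}(x)=\{(y,u)\in\mathbb{R}^{m+q}: \mathcal{L}(x,y,u)=0,\ u\ge 0,\ g(x,y)\le 0,\ u^\top g(x,y)=0\}$; for $t>0$, $\mathcal{D}^t(x)=\{(y,u)\in\mathbb{R}^{m+q}: \mathcal{L}(x,y,u)=0,\ u\ge 0,\ g(x,y)\le 0,\ -u_ig_i(x,y)\le t,\ i=1,\dots,q\}$, assumed nonempty throughout. Notation: for $\beta\in\mathbb{R}^m$, $\nabla_y g_i(x,y)\beta=\sum_{l=1}^m\beta_l\,\partial g_i/\partial y_l(x,y)$; $\nabla_x\mathcal{L},\nabla_y\mathcal{L},\nabla G,\nabla_xg,\nabla_yg$ are Jacobians; $\nabla_{x,y}\mathcal{L}$ and $\nabla g$ are Jacobians with respect to $(x,y)$.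 Upper-level regular at $\bar x$: $[\alpha\ge0,\ \alpha^\top G(\bar x)=0,\ \nabla G(\bar x)^\top\alpha=0]\Rightarrow\alpha=0$. Index sets at $(x,y,u)$: $\eta=\{i:u_i=0,\,g_i(x,y)<0\}$, $\theta=\{i:u_i=0,\,g_i(x,y)=0\}$, $\nu=\{i:u_i>0,\,g_i(x,y)=0\}$. M-multiplier sets at $(x,y,u)$: $\Lambda^{em}(x,y,u,0)$ is the set of $(\beta,\gamma)\in\mathbb{R}^{m+q}$ with $\nabla_yg_i(x,y)\beta=0$ for $i\in\nu$, $\gamma_i=0$ for $i\in\eta$, for each $i\in\theta$ either ($\gamma_i>0$ and $\nabla_yg_i(x,y)\beta>0$) or $\gamma_i\nabla_yg_i(x,y)\beta=0$, and $\nabla_{x,y}\mathcal{L}(x,y,u)^\top\beta+\nabla g(x,y)^\top\gamma=0$. $\Lambda^{em}_y(x,y,u,0)$ is defined in the same way with the last equation replaced by $\nabla_y\mathcal{L}(x,y,u)^\top\beta+\nabla_yg(x,y)^\top\gamma=0$. $(A_1^m)$ at $(x,y,u)$: $(\beta,\gamma)\in\Lambda^{em}(x,y,u,0)\Rightarrow\beta=0,\gamma=0$. $(A_2^m)$ at $(x,y,u)$: $(\beta,\gamma)\in\Lambda_y^{em}(x,y,u,0)\Rightarrow\nabla_x\mathcal{L}(x,y,u)^\top\beta+\nabla_xg(x,y)^\top\gamma=0$. *)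

theory Defs
  imports "HOL-Analysis.Analysis"
begin

text \<open>
  Vectors are elements of \<open>real ^ 'k\<close>; inequalities such as \<open>0 \<le> u\<close> or \<open>g (x, y) \<le> 0\<close> are the
  library's componentwise order on them.
\<close>

definition twice_continuously_differentiable ::
    "('a::real_normed_vector \<Rightarrow> 'b::real_normed_vector) \<Rightarrow> bool" where
  "twice_continuously_differentiable F \<longleftrightarrow>
     (\<exists>(F' :: 'a \<Rightarrow> 'a \<Rightarrow>\<^sub>L 'b) (F'' :: 'a \<Rightarrow> 'a \<Rightarrow>\<^sub>L 'a \<Rightarrow>\<^sub>L 'b).
        (\<forall>z. (F has_derivative blinfun_apply (F' z)) (at z)) \<and>
        (\<forall>z. (F' has_derivative blinfun_apply (F'' z)) (at z)) \<and>
        continuous_on UNIV F'')"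

definition grad :: "(real ^ 'k \<Rightarrow> real) \<Rightarrow> real ^ 'k \<Rightarrow> real ^ 'k" where
  "grad F z = (\<chi> l. frechet_derivative F (at z) (axis l 1))"

text \<open>
  The Jacobian with respect to \<open>(x, y)\<close>. The space of pairs is identified with \<open>real ^ ('n + 'm)\<close>,
  the left summand indexing the coordinates of \<open>x\<close> and the right one those of \<open>y\<close>.
\<close>

definition jacobian_xy ::
    "((real ^ 'n) \<times> (real ^ 'm) \<Rightarrow> real ^ 'k) \<Rightarrow> real ^ 'n \<Rightarrow> real ^ 'm \<Rightarrow> real ^ ('n + 'm) ^ 'k" where
  "jacobian_xy F x y =
     jacobian (\<lambda>z :: real ^ ('n + 'm). F (\<chi> j. z $ Inl j, \<chi> l. z $ Inr l))
       (at (\<chi> s. case s of Inl j \<Rightarrow> x $ j | Inr l \<Rightarrow> y $ l))"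

definition upper_feasible :: "(real ^ 'n \<Rightarrow> real ^ 'p) \<Rightarrow> (real ^ 'n) set" where
  "upper_feasible G = {x. G x \<le> 0}"

definition lower_solutions ::
    "((real ^ 'n) \<times> (real ^ 'm) \<Rightarrow> real) \<Rightarrow> ((real ^ 'n) \<times> (real ^ 'm) \<Rightarrow> real ^ 'q) \<Rightarrow>
     real ^ 'n \<Rightarrow> (real ^ 'm) set" where
  "lower_solutions f g x = {y. is_arg_min (\<lambda>y. f (x, y)) (\<lambda>y. g (x, y) \<le> 0) y}"

definition grad_y ::
    "((real ^ 'n) \<times> (real ^ 'm) \<Rightarrow> real ^ 'q) \<Rightarrow> 'q \<Rightarrow> real ^ 'n \<Rightarrow> real ^ 'm \<Rightarrow> real ^ 'm" where
  "grad_y g i x y = grad (\<lambda>y. g (x, y) $ i) y"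

definition Lag ::
    "((real ^ 'n) \<times> (real ^ 'm) \<Rightarrow> real) \<Rightarrow> ((real ^ 'n) \<times> (real ^ 'm) \<Rightarrow> real ^ 'q) \<Rightarrow>
     real ^ 'n \<Rightarrow> real ^ 'm \<Rightarrow> real ^ 'q \<Rightarrow> real ^ 'm" where
  "Lag f g x y u = grad (\<lambda>y. f (x, y)) y + (\<Sum>i\<in>UNIV. u $ i *\<^sub>R grad_y g i x y)"

definition KKT ::
    "((real ^ 'n) \<times> (real ^ 'm) \<Rightarrow> real) \<Rightarrow> ((real ^ 'n) \<times> (real ^ 'm) \<Rightarrow> real ^ 'q) \<Rightarrow>
     real ^ 'n \<Rightarrow> ((real ^ 'm) \<times> (real ^ 'q)) set" where
  "KKT f g x = {(y, u). Lag f g x y u = 0 \<and> 0 \<le> u \<and> g (x, y) \<le> 0 \<and> u \<bullet> g (x, y) = 0}"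

definition KKT_relaxed ::
    "((real ^ 'n) \<times> (real ^ 'm) \<Rightarrow> real) \<Rightarrow> ((real ^ 'n) \<times> (real ^ 'm) \<Rightarrow> real ^ 'q) \<Rightarrow>
     real \<Rightarrow> real ^ 'n \<Rightarrow> ((real ^ 'm) \<times> (real ^ 'q)) set" where
  "KKT_relaxed f g t x =
     {(y, u). Lag f g x y u = 0 \<and> 0 \<le> u \<and> g (x, y) \<le> 0 \<and> (\<forall>i. - (u $ i) * g (x, y) $ i \<le> t)}"

definition upper_level_regular :: "(real ^ 'n \<Rightarrow> real ^ 'p) \<Rightarrow> real ^ 'n \<Rightarrow> bool" where
  "upper_level_regular G x \<longleftrightarrow>
     (\<forall>\<alpha>. 0 \<le> \<alpha> \<and> \<alpha> \<bullet> G x = 0 \<and> transpose (jacobian G (at x)) *v \<alpha> = 0 \<longrightarrow> \<alpha> = 0)"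

definition eta_set ::
    "((real ^ 'n) \<times> (real ^ 'm) \<Rightarrow> real ^ 'q) \<Rightarrow> real ^ 'n \<Rightarrow> real ^ 'm \<Rightarrow> real ^ 'q \<Rightarrow> 'q set" where
  "eta_set g x y u = {i. u $ i = 0 \<and> g (x, y) $ i < 0}"

definition theta_set ::
    "((real ^ 'n) \<times> (real ^ 'm) \<Rightarrow> real ^ 'q) \<Rightarrow> real ^ 'n \<Rightarrow> real ^ 'm \<Rightarrow> real ^ 'q \<Rightarrow> 'q set" where
  "theta_set g x y u = {i. u $ i = 0 \<and> g (x, y) $ i = 0}"

definition nu_set ::
    "((real ^ 'n) \<times> (real ^ 'm) \<Rightarrow> real ^ 'q) \<Rightarrow> real ^ 'n \<Rightarrow> real ^ 'm \<Rightarrow> real ^ 'q \<Rightarrow> 'q set" where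
  "nu_set g x y u = {i. u $ i > 0 \<and> g (x, y) $ i = 0}"

text \<open>The sign conditions shared by the two M-multiplier sets below.\<close>

definition M_signs ::
    "((real ^ 'n) \<times> (real ^ 'm) \<Rightarrow> real ^ 'q) \<Rightarrow> real ^ 'n \<Rightarrow> real ^ 'm \<Rightarrow> real ^ 'q \<Rightarrow>
     real ^ 'm \<Rightarrow> real ^ 'q \<Rightarrow> bool" where
  "M_signs g x y u \<beta> \<gamma> \<longleftrightarrow>
     (\<forall>i\<in>nu_set g x y u. grad_y g i x y \<bullet> \<beta> = 0) \<and>
     (\<forall>i\<in>eta_set g x y u. \<gamma> $ i = 0) \<and>
     (\<forall>i\<in>theta_set g x y u.
        (\<gamma> $ i > 0 \<and> grad_y g i x y \<bullet> \<beta> > 0) \<or> \<gamma> $ i * (grad_y g i x y \<bullet> \<beta>) = 0)"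

definition Lambda_em ::
    "((real ^ 'n) \<times> (real ^ 'm) \<Rightarrow> real) \<Rightarrow> ((real ^ 'n) \<times> (real ^ 'm) \<Rightarrow> real ^ 'q) \<Rightarrow>
     real ^ 'n \<Rightarrow> real ^ 'm \<Rightarrow> real ^ 'q \<Rightarrow> ((real ^ 'm) \<times> (real ^ 'q)) set" where
  "Lambda_em f g x y u =
     {(\<beta>, \<gamma>). M_signs g x y u \<beta> \<gamma> \<and>
        transpose (jacobian_xy (\<lambda>(x, y). Lag f g x y u) x y) *v \<beta>
          + transpose (jacobian_xy g x y) *v \<gamma> = 0}"

definition Lambda_em_y ::
    "((real ^ 'n) \<times> (real ^ 'm) \<Rightarrow> real) \<Rightarrow> ((real ^ 'n) \<times> (real ^ 'm) \<Rightarrow> real ^ 'q) \<Rightarrow>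
     real ^ 'n \<Rightarrow> real ^ 'm \<Rightarrow> real ^ 'q \<Rightarrow> ((real ^ 'm) \<times> (real ^ 'q)) set" where
  "Lambda_em_y f g x y u =
     {(\<beta>, \<gamma>). M_signs g x y u \<beta> \<gamma> \<and>
        transpose (jacobian (\<lambda>y. Lag f g x y u) (at y)) *v \<beta>
          + transpose (jacobian (\<lambda>y. g (x, y)) (at y)) *v \<gamma> = 0}"

definition A1m ::
    "((real ^ 'n) \<times> (real ^ 'm) \<Rightarrow> real) \<Rightarrow> ((real ^ 'n) \<times> (real ^ 'm) \<Rightarrow> real ^ 'q) \<Rightarrow>
     real ^ 'n \<Rightarrow> real ^ 'm \<Rightarrow> real ^ 'q \<Rightarrow> bool" where
  "A1m f g x y u \<longleftrightarrow> (\<forall>\<beta> \<gamma>. (\<beta>, \<gamma>) \<in> Lambda_em f g x y u \<longrightarrow> \<beta> = 0 \<and> \<gamma> = 0)"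

definition A2m ::
    "((real ^ 'n) \<times> (real ^ 'm) \<Rightarrow> real) \<Rightarrow> ((real ^ 'n) \<times> (real ^ 'm) \<Rightarrow> real ^ 'q) \<Rightarrow>
     real ^ 'n \<Rightarrow> real ^ 'm \<Rightarrow> real ^ 'q \<Rightarrow> bool" where
  "A2m f g x y u \<longleftrightarrow> (\<forall>\<beta> \<gamma>. (\<beta>, \<gamma>) \<in> Lambda_em_y f g x y u \<longrightarrow>
     transpose (jacobian (\<lambda>x. Lag f g x y u) (at x)) *v \<beta>
       + transpose (jacobian (\<lambda>x. g (x, y)) (at x)) *v \<gamma> = 0)"

end

(*
  Pairing the stationarity equation in (b) with beta produces the Hessian form of the lower-level
  Lagrangian, which is nonnegative by convexity, on one side and
  - sum_i (gamma_i mu_i + delta_i^2 t) on the other. Hence delta = 0 and gamma_i mu_i = 0, so the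
  multipliers solve a system no longer involving t, whose solutions form a closed set, conical in
  (beta, gamma). At the reference point (beta, -gamma) is an M-multiplier, so the system has only the
  trivial solution there by (A2) and (A1), and by compactness of the unit sphere the same holds
  nearby. Convexity is what makes M-type conditions suffice: without it the limits of relaxed
  multipliers are in general only of C-type. Part (a) is the same compactness argument.
*)

theory Submission
  imports Defs
begin

section \<open>Jacobians and gradients expressed through Frechet derivatives\<close>

lemma matrix_mult_eq:
  fixes F' :: "real ^ 'a \<Rightarrow> real ^ 'b"
  assumes "linear F'"
  shows "matrix F' *v h = F' h"
  using assms by (simp add: matrix_works linear_matrix_vector_mul_eq)

text \<open>The transposed matrix is the adjoint of the derivative. This lets the stationarity
  equations be read as statements about any known derivative \<open>F'\<close>.\<close>

lemma transpose_jacobian_inner: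
  fixes F :: "real ^ 'a \<Rightarrow> real ^ 'b"
  assumes "(F has_derivative F') (at x)"
  shows "(transpose (jacobian F (at x)) *v a) \<bullet> h = a \<bullet> F' h"
proof -
  have "jacobian F (at x) = matrix F'"
    unfolding jacobian_def using frechet_derivative_at[OF assms] by simp
  moreover have "linear F'"
    using assms by (rule has_derivative_linear)
  ultimately show ?thesis
    by (simp add: dot_lmul_matrix matrix_mult_eq)
qed

lemma transpose_jacobian_nth:
  fixes F :: "real ^ 'a \<Rightarrow> real ^ 'b"
  assumes "(F has_derivative F') (at x)"
  shows "(transpose (jacobian F (at x)) *v a) $ j = a \<bullet> F' (axis j 1)"
  using transpose_jacobian_inner[OF assms, of a "axis j 1"] by (simp add: inner_axis)

lemma has_derivative_vecI:
  fixes F :: "'a::real_normed_vector \<Rightarrow> real ^ 'b"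
  assumes "\<And>i. ((\<lambda>x. F x $ i) has_derivative (\<lambda>h. F' h $ i)) (at x within S)"
  shows "(F has_derivative F') (at x within S)"
  using assms
  by (subst has_derivative_componentwise_within) (auto simp: Basis_vec_def inner_axis)

lemma grad_inner:
  assumes "(F has_derivative F') (at y)"
  shows "grad F y \<bullet> h = F' h"
proof -
  have lin: "linear F'"
    using assms by (rule has_derivative_linear)
  have "F' h = F' (\<Sum>i\<in>UNIV. h $ i *\<^sub>R axis i 1)"
    using basis_expansion[of h] by (simp add: scalar_mult_eq_scaleR)
  also have "\<dots> = (\<Sum>i\<in>UNIV. h $ i * F' (axis i 1))"
    using lin by (simp add: linear_sum linear_scale)
  also have "\<dots> = grad F y \<bullet> h"
    using frechet_derivative_at[OF assms]
    by (simp add: grad_def inner_vec_def mult.commute)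
  finally show ?thesis by simp
qed

lemma grad_nth:
  assumes "(F has_derivative F') (at y)"
  shows "grad F y $ l = F' (axis l 1)"
  using grad_inner[OF assms, of "axis l 1"] by (simp add: inner_axis)

text \<open>Chain rule through the linear identification of the vectors indexed by a sum type with
  pairs. Coordinatewise, the joint Jacobian thus splits into the \<open>x\<close>-part and the
  \<open>y\<close>-part, which is how (A1) is later assembled from two partial equations.\<close>

lemma transpose_jacobian_xy:
  fixes F :: "(real ^ 'n) \<times> (real ^ 'm) \<Rightarrow> real ^ 'k"
  assumes "(F has_derivative F') (at (x, y))"
  shows "(transpose (jacobian_xy F x y) *v a) $ Inl j = a \<bullet> F' (axis j 1, 0)"
    and "(transpose (jacobian_xy F x y) *v a) $ Inr l = a \<bullet> F' (0, axis l 1)"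
proof -
  define E :: "real ^ ('n + 'm) \<Rightarrow> (real ^ 'n) \<times> (real ^ 'm)"
    where "E = (\<lambda>z. (\<chi> j. z $ Inl j, \<chi> l. z $ Inr l))"
  define w :: "real ^ ('n + 'm)"
    where "w = (\<chi> s. case s of Inl j \<Rightarrow> x $ j | Inr l \<Rightarrow> y $ l)"
  have "linear E"
    by (rule linearI) (auto simp: E_def vec_eq_iff)
  then have E': "(E has_derivative E) (at w)"
    by (intro bounded_linear_imp_has_derivative linear_conv_bounded_linear[THEN iffD1])
  have "E w = (x, y)"
    by (simp add: E_def w_def vec_eq_iff)
  then have "(F \<circ> E has_derivative F' \<circ> E) (at w)"
    using diff_chain_at[OF E'] assms by simp
  note D = transpose_jacobian_nth[OF this]
  have J: "jacobian_xy F x y = jacobian (F \<circ> E) (at w)"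
    by (simp add: jacobian_xy_def E_def w_def comp_def)
  \<comment> \<open>Unit vectors of the sum index become unit vectors in one factor and zero in the
    other.\<close>
  have "E (axis (Inl j) 1) = (axis j 1, 0)" "E (axis (Inr l) 1) = (0, axis l 1)"
    by (auto simp: E_def vec_eq_iff axis_def)
  then show "(transpose (jacobian_xy F x y) *v a) $ Inl j = a \<bullet> F' (axis j 1, 0)"
    and "(transpose (jacobian_xy F x y) *v a) $ Inr l = a \<bullet> F' (0, axis l 1)"
    unfolding J D by simp_all
qed

section \<open>Convexity and second derivatives\<close>

lemma convex_on_sum_fun:
  assumes "convex S" and "\<And>i. i \<in> I \<Longrightarrow> convex_on S (f i)"
  shows "convex_on S (\<lambda>x. \<Sum>i\<in>I. f i x)"
  using assms(2)
  by (induction I rule: infinite_finite_induct)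
    (auto intro!: convex_on_add simp: convex_on_const \<open>convex S\<close>)

text \<open>The first derivative of a convex function is monotone, and a monotone function has a
  nonnegative derivative wherever one exists.\<close>

lemma convex_on_imp_second_derivative_nonneg:
  fixes \<phi> \<phi>' :: "real \<Rightarrow> real"
  assumes conv: "convex_on UNIV \<phi>"
    and D: "\<And>s. (\<phi> has_real_derivative \<phi>' s) (at s)"
    and D2: "(\<phi>' has_real_derivative c) (at a)"
  shows "c \<ge> 0"
proof -
  have "\<phi>' s \<le> \<phi>' r" if "s \<le> r" for s r
  proof (cases "s = r")
    case False
    \<comment> \<open>Adding the tangent inequalities at \<open>s\<close> and at \<open>r\<close>
      cancels the values of \<phi>.\<close>
    have "\<phi> r - \<phi> s \<ge> \<phi>' s * (r - s)" "\<phi> s - \<phi> r \<ge> \<phi>' r * (s - r)"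
      by (rule convex_on_imp_above_tangent[OF conv]; use D in simp)+
    then have "0 \<le> (\<phi>' r - \<phi>' s) * (r - s)"
      by (simp add: algebra_simps)
    then show ?thesis
      using that False by (simp add: zero_le_mult_iff)
  qed simp
  then have "mono_on UNIV \<phi>'"
    by (simp add: mono_on_def)
  then show ?thesis
    using D2 by (rule mono_on_imp_deriv_nonneg) simp
qed

section \<open>Openness of having only the trivial solution\<close>

text \<open>A nonzero solution can be rescaled to the unit sphere. The parameters admitting one
  therefore form the projection of a closed set along a compact factor, which is closed.\<close>

lemma open_trivial_fibres:
  fixes P :: "'a::euclidean_space \<Rightarrow> 'b::euclidean_space \<Rightarrow> bool"
  assumes closed: "closed {(v, p). P v p}"
    and cone: "\<And>c v p. P v p \<Longrightarrow> c > 0 \<Longrightarrow> P (c *\<^sub>R v) p"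
  shows "open {p. \<forall>v. P v p \<longrightarrow> v = 0}"
proof -
  have "closed {p. \<exists>v. v \<in> sphere 0 1 \<and> (v, p) \<in> {(v, p). P v p}}"
    using closed by (intro closed_compact_projection compact_sphere)
  moreover have "(\<exists>v. v \<in> sphere 0 1 \<and> P v p) \<longleftrightarrow> (\<exists>v. P v p \<and> v \<noteq> 0)" for p
  proof
    assume "\<exists>v. P v p \<and> v \<noteq> 0"
    then obtain v where "P v p" "v \<noteq> 0"
      by blast
    then have "P (inverse (norm v) *\<^sub>R v) p" "norm (inverse (norm v) *\<^sub>R v) = 1"
      using cone by auto
    then show "\<exists>v. v \<in> sphere 0 1 \<and> P v p"
      by (intro exI[of _ "inverse (norm v) *\<^sub>R v"]) simp
  qed force
  ultimately have "closed {p. \<exists>v. P v p \<and> v \<noteq> 0}"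
    by simp
  then show ?thesis
    by (simp add: closed_def Collect_neg_eq[symmetric])
qed

text \<open>This settles part (a): the conditions on \<alpha> are homogeneous, and they are closed
  in (\<alpha>, x) because \<open>G\<close> and its derivative are continuous.\<close>

lemma open_upper_level_regular:
  assumes "twice_continuously_differentiable G"
  shows "open {x. upper_level_regular G x}"
proof -
  obtain G' G'' where
    G': "\<And>z. (G has_derivative blinfun_apply (G' z)) (at z)" and
    G'': "\<And>z. (G' has_derivative blinfun_apply (G'' z)) (at z)"
    using assms unfolding twice_continuously_differentiable_def by blast
  have cont: "continuous_on S G" "continuous_on S G'" for S
    using G' G'' by (meson continuous_at_imp_continuous_on has_derivative_continuous)+
  define P where "P \<alpha> x \<longleftrightarrow> 0 \<le> \<alpha> \<and> \<alpha> \<bullet> G x = 0 \<and> transpose (jacobian G (at x)) *v \<alpha> = 0"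
    for \<alpha> x
  have P: "P \<alpha> x \<longleftrightarrow> (\<forall>i. 0 \<le> \<alpha> $ i) \<and> \<alpha> \<bullet> G x = 0 \<and> (\<forall>j. \<alpha> \<bullet> G' x (axis j 1) = 0)" for \<alpha> x
    unfolding P_def
    by (simp add: less_eq_vec_def vec_eq_iff transpose_jacobian_nth[OF G'] del: transpose_matrix_vector)
  have "closed {(\<alpha>, x). P \<alpha> x}"
    unfolding P case_prod_beta
    by (intro closed_Collect_conj closed_Collect_all closed_Collect_le closed_Collect_eq
        continuous_intros continuous_on_compose2[OF cont(1)] continuous_on_compose2[OF cont(2)]) auto
  then have "open {x. \<forall>\<alpha>. P \<alpha> x \<longrightarrow> \<alpha> = 0}"
    by (rule open_trivial_fibres) (simp add: P)
  then show ?thesis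
    by (simp add: P_def upper_level_regular_def)
qed

section \<open>Partial derivatives and the lower-level Lagrangian\<close>

lemma has_derivative_y:
  assumes "(F has_derivative F') (at (x, y))"
  shows "((\<lambda>y. F (x, y)) has_derivative (\<lambda>k. F' (0, k))) (at y)"
  by (rule has_derivative_compose[of "\<lambda>y. (x, y)" "\<lambda>k. (0, k)" y UNIV F F', OF _ assms])
    (auto intro!: derivative_eq_intros)

lemma has_derivative_x:
  assumes "(F has_derivative F') (at (x, y))"
  shows "((\<lambda>x. F (x, y)) has_derivative (\<lambda>k. F' (k, 0))) (at x)"
  by (rule has_derivative_compose[of "\<lambda>x. (x, y)" "\<lambda>k. (k, 0)" x UNIV F F', OF _ assms])
    (auto intro!: derivative_eq_intros)

text \<open>Fixes witnesses of the derivatives whose existence twice continuous differentiability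
  asserts, so that later formulas can name them.\<close>

locale C2_lower_level =
  fixes f :: "(real ^ 'n) \<times> (real ^ 'm) \<Rightarrow> real"
    and g :: "(real ^ 'n) \<times> (real ^ 'm) \<Rightarrow> real ^ 'q"
    and f' f'' g' g''
  assumes f': "\<And>z. (f has_derivative blinfun_apply (f' z)) (at z)"
    and f'': "\<And>z. (f' has_derivative blinfun_apply (f'' z)) (at z)"
    and cont_f'': "continuous_on UNIV f''"
    and g': "\<And>z. (g has_derivative blinfun_apply (g' z)) (at z)"
    and g'': "\<And>z. (g' has_derivative blinfun_apply (g'' z)) (at z)"
    and cont_g'': "continuous_on UNIV g''"
begin

lemma continuous_on_data:
  "continuous_on S g" "continuous_on S g'"
  using g' g'' by (meson continuous_at_imp_continuous_on has_derivative_continuous)+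

lemma has_derivative_g_nth:
  "((\<lambda>z. g z $ i) has_derivative (\<lambda>h. g' z h $ i)) (at z)"
  by (rule bounded_linear.has_derivative[OF bounded_linear_vec_nth g'])

lemma grad_y_inner: "grad_y g i x y \<bullet> h = g' (x, y) (0, h) $ i"
  unfolding grad_y_def by (rule grad_inner[OF has_derivative_y[OF has_derivative_g_nth]])

lemma grad_y_nth: "grad_y g i x y $ l = g' (x, y) (0, axis l 1) $ i"
  unfolding grad_y_def by (rule grad_nth[OF has_derivative_y[OF has_derivative_g_nth]])

lemma Lag_inner:
  "Lag f g x y u \<bullet> h = f' (x, y) (0, h) + u \<bullet> g' (x, y) (0, h)"
  unfolding Lag_def inner_add_left inner_sum_left inner_scaleR_left grad_y_inner
    grad_inner[OF has_derivative_y[OF f']]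
  by (simp add: inner_vec_def)

text \<open>The derivative of the Lagrangian gradient in direction \<open>d\<close> of the pair (x,
  y), with \<open>u\<close> held fixed. Writing it through \<open>f''\<close> and \<open>g''\<close>
  makes its joint continuity in \<open>z\<close> and \<open>u\<close> visible; directions
  \<open>(0, k)\<close> give the Hessian in \<open>y\<close>.\<close>

definition Lag_deriv where
  "Lag_deriv z u d = (\<chi> l. f'' z d (0, axis l 1) + u \<bullet> g'' z d (0, axis l 1))"

lemma has_derivative_Lag:
  "((\<lambda>z. Lag f g (fst z) (snd z) u) has_derivative Lag_deriv z u) (at z)"
proof (rule has_derivative_vecI)
  fix l
  have "Lag f g (fst z) (snd z) u $ l = f' z (0, axis l 1) + u \<bullet> g' z (0, axis l 1)" for z
    using Lag_inner[of "fst z" "snd z" u "axis l 1"] by (simp add: inner_axis)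
  then show "((\<lambda>z. Lag f g (fst z) (snd z) u $ l) has_derivative (\<lambda>h. Lag_deriv z u h $ l)) (at z)"
    unfolding Lag_deriv_def
    by (auto intro!: derivative_eq_intros f'' g'')
qed

lemma linear_Lag_deriv: "linear (Lag_deriv z u)"
  using has_derivative_Lag by (rule has_derivative_linear)

lemma has_derivative_Lag_pair:
  "((\<lambda>(x, y). Lag f g x y u) has_derivative Lag_deriv z u) (at z)"
  using has_derivative_Lag by (simp add: case_prod_unfold)

lemmas has_derivative_Lag_x = has_derivative_x[OF has_derivative_Lag_pair, simplified]
lemmas has_derivative_Lag_y = has_derivative_y[OF has_derivative_Lag_pair, simplified]

lemma transpose_jacobian_g_y:
  "transpose (jacobian (\<lambda>y. g (x, y)) (at y)) *v \<gamma> = (\<Sum>i\<in>UNIV. \<gamma> $ i *\<^sub>R grad_y g i x y)"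
  by (simp add: vec_eq_iff transpose_jacobian_nth[OF has_derivative_y[OF g']] grad_y_nth
      inner_vec_def del: transpose_matrix_vector)

text \<open>For \<open>u\<close> nonnegative the scalar Lagrangian is convex in \<open>y\<close>,
  and the quadratic form is its second derivative along the line through \<open>y\<close> with
  direction \<beta>.\<close>

lemma Lag_deriv_psd:
  assumes "convex_on UNIV (\<lambda>y. f (x, y))"
    and "\<And>i. convex_on UNIV (\<lambda>y. g (x, y) $ i)"
    and "0 \<le> u"
  shows "0 \<le> \<beta> \<bullet> Lag_deriv (x, y) u (0, \<beta>)"
proof -
  define \<psi> where "\<psi> = (\<lambda>y. f (x, y) + (\<Sum>i\<in>UNIV. u $ i * g (x, y) $ i))"
  define \<phi> where "\<phi> = (\<lambda>s. \<psi> (y + s *\<^sub>R \<beta>))"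
  have line: "((\<lambda>s. y + s *\<^sub>R \<beta>) has_derivative (\<lambda>h. h *\<^sub>R \<beta>)) (at s)" for s
    by (auto intro!: derivative_eq_intros)
  have "convex_on UNIV \<psi>"
    unfolding \<psi>_def using assms
    by (intro convex_on_add convex_on_sum_fun convex_on_cmul) (auto simp: less_eq_vec_def)
  then have "convex_on UNIV \<phi>"
    unfolding convex_on_def \<phi>_def
  proof (intro conjI ballI allI impI convex_UNIV)
    fix r s a b :: real
    assume "0 \<le> a" "0 \<le> b" "a + b = 1"
    moreover from this have "y + (a *\<^sub>R r + b *\<^sub>R s) *\<^sub>R \<beta> = a *\<^sub>R (y + r *\<^sub>R \<beta>) + b *\<^sub>R (y + s *\<^sub>R \<beta>)"
      by (simp add: algebra_simps flip: scaleR_add_left)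
    ultimately show "\<psi> (y + (a *\<^sub>R r + b *\<^sub>R s) *\<^sub>R \<beta>)
        \<le> a * \<psi> (y + r *\<^sub>R \<beta>) + b * \<psi> (y + s *\<^sub>R \<beta>)"
      using \<open>convex_on UNIV \<psi>\<close> by (simp add: convex_on_def)
  qed
  \<comment> \<open>\<open>Lag\<close> is the gradient in \<open>y\<close> of the scalar Lagrangian
    \<psi>, so this is the chain rule along the line.\<close>
  moreover have "(\<phi> has_real_derivative Lag f g x (y + s *\<^sub>R \<beta>) u \<bullet> \<beta>) (at s)" for s
  proof -
    have "(\<psi> has_derivative (\<lambda>k. Lag f g x (y + s *\<^sub>R \<beta>) u \<bullet> k)) (at (y + s *\<^sub>R \<beta>))"
      unfolding \<psi>_def Lag_inner inner_vec_def[of u] inner_real_def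
      by (intro has_derivative_add has_derivative_sum has_derivative_mult_right
          has_derivative_y f' has_derivative_g_nth)
    from has_derivative_compose[OF line this] show ?thesis
      unfolding \<phi>_def has_field_derivative_def by (simp add: mult_commute_abs)
  qed
  moreover have "((\<lambda>s. Lag f g x (y + s *\<^sub>R \<beta>) u \<bullet> \<beta>) has_real_derivative
      \<beta> \<bullet> Lag_deriv (x, y) u (0, \<beta>)) (at 0)"
  proof -
    \<comment> \<open>The base point is written as the value of the line at parameter 0, the form
      that composition with the line requires.\<close>
    have "((\<lambda>y. Lag f g x y u) has_derivative (\<lambda>k. Lag_deriv (x, y) u (0, k))) (at (y + 0 *\<^sub>R \<beta>))"
      using has_derivative_Lag_y by simp
    from has_derivative_inner_left[OF has_derivative_compose[OF line this], of \<beta>]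
    have "((\<lambda>s. Lag f g x (y + s *\<^sub>R \<beta>) u \<bullet> \<beta>) has_derivative
        (\<lambda>h. Lag_deriv (x, y) u (0, h *\<^sub>R \<beta>) \<bullet> \<beta>)) (at 0)" .
    moreover have "Lag_deriv (x, y) u (0, h *\<^sub>R \<beta>) = h *\<^sub>R Lag_deriv (x, y) u (0, \<beta>)" for h
      using linear_scale[OF linear_Lag_deriv, of "(x, y)" u h "(0, \<beta>)"] by simp
    ultimately show ?thesis
      unfolding has_field_derivative_def by (simp add: inner_commute mult_commute_abs)
  qed
  ultimately show ?thesis
    by (rule convex_on_imp_second_derivative_nonneg)
qed

section \<open>The limiting multiplier system\<close>

text \<open>What remains of the system in (b) once \<delta> vanishes and \<mu> is eliminated;
  neither \<open>t\<close> nor a sign of \<gamma> occurs. Products replace the index sets so that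
  the conditions stay closed when the base point, and with it the active set, varies.\<close>

definition critical where
  "critical x y u \<beta> \<gamma> \<longleftrightarrow>
     transpose (jacobian (\<lambda>y. Lag f g x y u) (at y)) *v \<beta> = (\<Sum>i\<in>UNIV. \<gamma> $ i *\<^sub>R grad_y g i x y) \<and>
     (\<forall>i. u $ i * (grad_y g i x y \<bullet> \<beta>) = 0 \<and> \<gamma> $ i * g (x, y) $ i = 0 \<and>
          \<gamma> $ i * (grad_y g i x y \<bullet> \<beta>) = 0)"

lemma critical_iff:
  "critical x y u \<beta> \<gamma> \<longleftrightarrow>
     (\<forall>j. \<beta> \<bullet> Lag_deriv (x, y) u (0, axis j 1) = (\<Sum>i\<in>UNIV. \<gamma> $ i * g' (x, y) (0, axis j 1) $ i)) \<and>
     (\<forall>i. u $ i * g' (x, y) (0, \<beta>) $ i = 0 \<and> \<gamma> $ i * g (x, y) $ i = 0 \<and>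
          \<gamma> $ i * g' (x, y) (0, \<beta>) $ i = 0)"
  unfolding critical_def grad_y_inner
  by (simp add: vec_eq_iff transpose_jacobian_nth[OF has_derivative_Lag_y] grad_y_nth
      del: transpose_matrix_vector)

text \<open>Continuity of the second derivatives makes the system closed in multipliers and base
  point together. It is also conical, since scaling (\<beta>, \<gamma>) multiplies each equation by
  \<open>c\<close> or by its square.\<close>

lemma open_no_critical:
  "open {(x, y, u). \<forall>\<beta> \<gamma>. critical x y u \<beta> \<gamma> \<longrightarrow> \<beta> = 0 \<and> \<gamma> = 0}"
proof -
  have "closed {(v, p). critical (fst p) (fst (snd p)) (snd (snd p)) (fst v) (snd v)}"
    unfolding critical_iff Lag_deriv_def case_prod_beta
    by (intro closed_Collect_conj closed_Collect_all closed_Collect_eq continuous_intros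
        continuous_on_compose2[OF cont_f''] continuous_on_compose2[OF cont_g'']
        continuous_on_compose2[OF continuous_on_data(1)]
        continuous_on_compose2[OF continuous_on_data(2)]) auto
  moreover have "critical x y u (c *\<^sub>R \<beta>) (c *\<^sub>R \<gamma>)" if "critical x y u \<beta> \<gamma>" for x y u c \<beta> \<gamma>
    using that
    by (auto simp: critical_def matrix_vector_mult_scaleR scaleR_sum_right
        simp flip: scaleR_scaleR simp del: transpose_matrix_vector)
  ultimately have "open {p. \<forall>v. critical (fst p) (fst (snd p)) (snd (snd p)) (fst v) (snd v) \<longrightarrow> v = 0}"
    by (intro open_trivial_fibres) auto
  then show ?thesis
    by (simp add: zero_prod_def case_prod_unfold)
qed

text \<open>A critical pair gives the M-multiplier (\<beta>, -\<gamma>) for the equation in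
  \<open>y\<close>. (A2) adds the equation in \<open>x\<close>, so the pair solves the joint system,
  where (A1) leaves only zero.\<close>

lemma A1m_A2m_imp_no_critical:
  assumes A1: "A1m f g x y u" and A2: "A2m f g x y u"
    and crit: "critical x y u \<beta> \<gamma>"
  shows "\<beta> = 0 \<and> \<gamma> = 0"
proof -
  \<comment> \<open>Positive \<open>u $ i\<close> kills the directional derivative, negative
    \<open>g (x, y) $ i\<close> kills \<open>\<gamma> $ i\<close>, and on the biactive set the
    second M-alternative holds because the product is zero.\<close>
  have "M_signs g x y u \<beta> (- \<gamma>)"
    using crit by (force simp: M_signs_def critical_def nu_set_def eta_set_def theta_set_def)
  moreover have y0: "transpose (jacobian (\<lambda>y. Lag f g x y u) (at y)) *v \<beta>
      + transpose (jacobian (\<lambda>y. g (x, y)) (at y)) *v (- \<gamma>) = 0"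
    using crit by (simp add: critical_def transpose_jacobian_g_y sum_negf del: transpose_matrix_vector)
  ultimately have "(\<beta>, - \<gamma>) \<in> Lambda_em_y f g x y u"
    by (simp add: Lambda_em_y_def)
  with A2 have x0: "transpose (jacobian (\<lambda>x. Lag f g x y u) (at x)) *v \<beta>
      + transpose (jacobian (\<lambda>x. g (x, y)) (at x)) *v (- \<gamma>) = 0"
    by (simp add: A2m_def)
  have "(transpose (jacobian_xy (\<lambda>(x, y). Lag f g x y u) x y) *v \<beta>
      + transpose (jacobian_xy g x y) *v (- \<gamma>)) $ s = 0" for s
  proof (cases s)
    case (Inl j)
    then show ?thesis
      using x0[THEN arg_cong, of "\<lambda>v. v $ j"]
      by (simp add: transpose_jacobian_xy[OF has_derivative_Lag_pair] transpose_jacobian_xy[OF g']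
          transpose_jacobian_nth[OF has_derivative_Lag_x]
          transpose_jacobian_nth[OF has_derivative_x[OF g']] del: transpose_matrix_vector)
  next
    case (Inr l)
    then show ?thesis
      using y0[THEN arg_cong, of "\<lambda>v. v $ l"]
      by (simp add: transpose_jacobian_xy[OF has_derivative_Lag_pair] transpose_jacobian_xy[OF g']
          transpose_jacobian_nth[OF has_derivative_Lag_y]
          transpose_jacobian_nth[OF has_derivative_y[OF g']] del: transpose_matrix_vector)
  qed
  then have "(\<beta>, - \<gamma>) \<in> Lambda_em f g x y u"
    using \<open>M_signs g x y u \<beta> (- \<gamma>)\<close>
    by (simp add: Lambda_em_def vec_eq_iff del: transpose_matrix_vector)
  with A1 show ?thesis
    unfolding A1m_def by fastforce
qed

text \<open>Pairing stationarity with \<beta> equates a nonnegative quadratic form with a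
  nonpositive sum, so every term of the sum vanishes.\<close>

lemma relaxed_multiplier_critical:
  assumes conv: "convex_on UNIV (\<lambda>y. f (x, y))" "\<And>i. convex_on UNIV (\<lambda>y. g (x, y) $ i)"
    and "t > 0" "0 \<le> u"
    and eq: "transpose (jacobian (\<lambda>y. Lag f g x y u) (at y)) *v \<beta>
             - (\<Sum>i\<in>UNIV. (\<gamma> $ i - \<delta> $ i * u $ i) *\<^sub>R grad_y g i x y) = 0"
    and sgn: "\<And>i. grad_y g i x y \<bullet> \<beta> + \<mu> $ i + \<delta> $ i * g (x, y) $ i = 0 \<and>
                \<gamma> $ i \<ge> 0 \<and> \<delta> $ i \<ge> 0 \<and> \<mu> $ i \<ge> 0 \<and>
                \<mu> $ i * u $ i = 0 \<and> \<gamma> $ i * g (x, y) $ i = 0 \<and>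
                \<delta> $ i * (u $ i * g (x, y) $ i + t) = 0"
  shows "\<delta> = 0" and "critical x y u \<beta> \<gamma>"
proof -
  have dual: "(\<gamma> $ i - \<delta> $ i * u $ i) * (grad_y g i x y \<bullet> \<beta>) = - (\<gamma> $ i * \<mu> $ i + (\<delta> $ i)\<^sup>2 * t)" for i
  proof -
    have "grad_y g i x y \<bullet> \<beta> = - \<mu> $ i - \<delta> $ i * g (x, y) $ i"
      using sgn[of i] by linarith
    \<comment> \<open>The last three terms contain complementarity products equal to zero. The
      contribution of \<open>t\<close> comes from replacing \<open>u $ i * g (x, y) $ i\<close> by
      \<open>- t\<close> where \<open>\<delta> $ i\<close> is nonzero.\<close>
    then have expand: "(\<gamma> $ i - \<delta> $ i * u $ i) * (grad_y g i x y \<bullet> \<beta>) =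
        - (\<gamma> $ i * \<mu> $ i + (\<delta> $ i)\<^sup>2 * t) - \<delta> $ i * (\<gamma> $ i * g (x, y) $ i) + \<delta> $ i * (\<mu> $ i * u $ i)
          + \<delta> $ i * (\<delta> $ i * (u $ i * g (x, y) $ i + t))"
      by (simp only:) (simp add: algebra_simps power2_eq_square)
    show ?thesis
      unfolding expand using sgn[of i] by auto
  qed
  have nonneg: "0 \<le> \<gamma> $ i * \<mu> $ i + (\<delta> $ i)\<^sup>2 * t" for i
    using sgn[of i] \<open>t > 0\<close> by simp
  have "\<beta> \<bullet> Lag_deriv (x, y) u (0, \<beta>) = (transpose (jacobian (\<lambda>y. Lag f g x y u) (at y)) *v \<beta>) \<bullet> \<beta>"
    by (simp only: transpose_jacobian_inner[OF has_derivative_Lag_y])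
  also have "\<dots> = (\<Sum>i\<in>UNIV. (\<gamma> $ i - \<delta> $ i * u $ i) *\<^sub>R grad_y g i x y) \<bullet> \<beta>"
    using eq by simp
  also have "\<dots> = - (\<Sum>i\<in>UNIV. \<gamma> $ i * \<mu> $ i + (\<delta> $ i)\<^sup>2 * t)"
    by (simp only: inner_sum_left inner_scaleR_left dual sum_negf)
  finally have "(\<Sum>i\<in>UNIV. \<gamma> $ i * \<mu> $ i + (\<delta> $ i)\<^sup>2 * t) \<le> 0"
    using Lag_deriv_psd[OF conv \<open>0 \<le> u\<close>, of \<beta> y] by simp
  then have "(\<Sum>i\<in>UNIV. \<gamma> $ i * \<mu> $ i + (\<delta> $ i)\<^sup>2 * t) = 0"
    by (intro antisym sum_nonneg nonneg)
  then have "\<gamma> $ i * \<mu> $ i + (\<delta> $ i)\<^sup>2 * t = 0" for i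
    by (simp add: sum_nonneg_eq_0_iff nonneg)
  moreover have "0 \<le> \<gamma> $ i * \<mu> $ i" "0 \<le> (\<delta> $ i)\<^sup>2 * t" for i
    using sgn[of i] \<open>t > 0\<close> by simp_all
  ultimately have zero: "\<gamma> $ i * \<mu> $ i = 0" "(\<delta> $ i)\<^sup>2 * t = 0" for i
    by (metis add_nonneg_eq_0_iff)+
  then show "\<delta> = 0"
    using \<open>t > 0\<close> by (simp add: vec_eq_iff)
  then have "grad_y g i x y \<bullet> \<beta> = - \<mu> $ i" for i
    using sgn[of i] by simp
  \<comment> \<open>With \<delta> zero, the directional derivatives are the negatives of \<mu>. The
    products in \<open>critical\<close> therefore vanish by \<open>\<mu> $ i * u $ i = 0\<close> and
    by the relation \<open>\<gamma> $ i * \<mu> $ i = 0\<close> just obtained.\<close>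
  then show "critical x y u \<beta> \<gamma>"
    unfolding critical_def using eq sgn zero \<open>\<delta> = 0\<close> by (simp add: mult.commute)
qed

end

theorem theorem4p4:
  fixes f :: "(real ^ 'n) \<times> (real ^ 'm) \<Rightarrow> real"
    and G :: "real ^ 'n \<Rightarrow> real ^ 'p"
    and g :: "(real ^ 'n) \<times> (real ^ 'm) \<Rightarrow> real ^ 'q"
    and xbar :: "real ^ 'n" and ybar :: "real ^ 'm" and ubar :: "real ^ 'q"
  assumes f_C2: "twice_continuously_differentiable f"
    and G_C2: "twice_continuously_differentiable G"
    and g_C2: "twice_continuously_differentiable g"
    and S_nonempty: "\<And>x. x \<in> upper_feasible G \<Longrightarrow> lower_solutions f g x \<noteq> {}"
    and S_empty: "\<And>x. x \<notin> upper_feasible G \<Longrightarrow> lower_solutions f g x = {}"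
    and f_convex: "\<And>x. convex_on UNIV (\<lambda>y. f (x, y))"
    and g_convex: "\<And>x i. convex_on UNIV (\<lambda>y. g (x, y) $ i)"
    and Slater: "\<And>x. x \<in> upper_feasible G \<Longrightarrow> \<exists>y. \<forall>i. g (x, y) $ i < 0"
    and relaxed_nonempty:
      "\<And>t x. t > 0 \<Longrightarrow> x \<in> upper_feasible G \<Longrightarrow> KKT_relaxed f g t x \<noteq> {}"
    and regular: "upper_level_regular G xbar"
    and A1: "A1m f g xbar ybar ubar"
    and A2: "A2m f g xbar ybar ubar"
    and KKT_point: "(ybar, ubar) \<in> KKT f g xbar"
  shows "\<exists>U V. open U \<and> xbar \<in> U \<and> open V \<and> (ybar, ubar) \<in> V \<and>
    (\<forall>\<^sub>F t in at_right (0::real).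
      \<forall>x y u. x \<in> U \<inter> upper_feasible G \<and> (y, u) \<in> V \<inter> KKT_relaxed f g t x \<longrightarrow>
        (\<forall>\<alpha> :: real ^ 'p.
           0 \<le> \<alpha> \<and> \<alpha> \<bullet> G x = 0 \<and> transpose (jacobian G (at x)) *v \<alpha> = 0 \<longrightarrow> \<alpha> = 0) \<and>
        (\<forall>(\<beta> :: real ^ 'm) (\<gamma> :: real ^ 'q) (\<delta> :: real ^ 'q) (\<mu> :: real ^ 'q).
           transpose (jacobian (\<lambda>y. Lag f g x y u) (at y)) *v \<beta>
             - (\<Sum>i\<in>UNIV. (\<gamma> $ i - \<delta> $ i * u $ i) *\<^sub>R grad_y g i x y) = 0 \<and>
           (\<forall>i. grad_y g i x y \<bullet> \<beta> + \<mu> $ i + \<delta> $ i * g (x, y) $ i = 0 \<and>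
                \<gamma> $ i \<ge> 0 \<and> \<delta> $ i \<ge> 0 \<and> \<mu> $ i \<ge> 0 \<and>
                \<mu> $ i * u $ i = 0 \<and> \<gamma> $ i * g (x, y) $ i = 0 \<and>
                \<delta> $ i * (u $ i * g (x, y) $ i + t) = 0) \<longrightarrow>
           \<beta> = 0 \<and> \<delta> = 0 \<and> \<gamma> = 0 \<and> \<mu> = 0))"
proof -
  obtain f' f'' where
    "\<And>z. (f has_derivative blinfun_apply (f' z)) (at z)"
    "\<And>z. (f' has_derivative blinfun_apply (f'' z)) (at z)" "continuous_on UNIV f''"
    using f_C2 unfolding twice_continuously_differentiable_def by blast
  moreover obtain g' g'' where
    "\<And>z. (g has_derivative blinfun_apply (g' z)) (at z)"
    "\<And>z. (g' has_derivative blinfun_apply (g'' z)) (at z)" "continuous_on UNIV g''"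
    using g_C2 unfolding twice_continuously_differentiable_def by blast
  ultimately interpret C2_lower_level f g f' f'' g' g''
    by unfold_locales
  \<comment> \<open>\<open>W\<close> does not involve \<open>t\<close>, so the neighborhoods
    extracted from it serve all \<open>t\<close> at once.\<close>
  define W where "W = {(x, y, u). \<forall>\<beta> \<gamma>. critical x y u \<beta> \<gamma> \<longrightarrow> \<beta> = 0 \<and> \<gamma> = 0}"
  have "open W"
    unfolding W_def by (rule open_no_critical)
  moreover have "(xbar, (ybar, ubar)) \<in> W"
    using A1m_A2m_imp_no_critical[OF A1 A2] by (auto simp: W_def)
  ultimately obtain U V where UV: "open U" "open V" "(xbar, (ybar, ubar)) \<in> U \<times> V" "U \<times> V \<subseteq> W"
    by (rule open_prod_elim)
  \<comment> \<open>Intersecting \<open>U\<close> with \<open>R\<close> secures part (a); the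
    product neighborhood inside \<open>W\<close> secures part (b).\<close>
  define R where "R = {x. upper_level_regular G x}"
  have "open R" "xbar \<in> R"
    using open_upper_level_regular[OF G_C2] regular by (auto simp: R_def)
  show ?thesis
  proof (intro exI conjI)
    show "open (U \<inter> R)" "xbar \<in> U \<inter> R" "open V" "(ybar, ubar) \<in> V"
      using UV \<open>open R\<close> \<open>xbar \<in> R\<close> by auto
  next
    show "\<forall>\<^sub>F t in at_right (0::real).
      \<forall>x y u. x \<in> (U \<inter> R) \<inter> upper_feasible G \<and> (y, u) \<in> V \<inter> KKT_relaxed f g t x \<longrightarrow>
        (\<forall>\<alpha> :: real ^ 'p.
           0 \<le> \<alpha> \<and> \<alpha> \<bullet> G x = 0 \<and> transpose (jacobian G (at x)) *v \<alpha> = 0 \<longrightarrow> \<alpha> = 0) \<and>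
        (\<forall>(\<beta> :: real ^ 'm) (\<gamma> :: real ^ 'q) (\<delta> :: real ^ 'q) (\<mu> :: real ^ 'q).
           transpose (jacobian (\<lambda>y. Lag f g x y u) (at y)) *v \<beta>
             - (\<Sum>i\<in>UNIV. (\<gamma> $ i - \<delta> $ i * u $ i) *\<^sub>R grad_y g i x y) = 0 \<and>
           (\<forall>i. grad_y g i x y \<bullet> \<beta> + \<mu> $ i + \<delta> $ i * g (x, y) $ i = 0 \<and>
                \<gamma> $ i \<ge> 0 \<and> \<delta> $ i \<ge> 0 \<and> \<mu> $ i \<ge> 0 \<and>
                \<mu> $ i * u $ i = 0 \<and> \<gamma> $ i * g (x, y) $ i = 0 \<and>
                \<delta> $ i * (u $ i * g (x, y) $ i + t) = 0) \<longrightarrow>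
           \<beta> = 0 \<and> \<delta> = 0 \<and> \<gamma> = 0 \<and> \<mu> = 0)"
      \<comment> \<open>Only positivity of \<open>t\<close> is extracted from the filter: the
        conclusion holds for every positive \<open>t\<close>.\<close>
      using eventually_at_right_less[of "0::real"]
    proof (rule eventually_mono, intro allI impI, goal_cases)
      case (1 t x y u)
      then have "x \<in> R" and W: "(x, (y, u)) \<in> W" and u: "0 \<le> u"
        using UV(4) by (auto simp: KKT_relaxed_def)
      show ?case
      proof ((rule conjI; intro allI impI), goal_cases)
        case (1 \<alpha>)
        with \<open>x \<in> R\<close> show ?case
          unfolding R_def upper_level_regular_def by blast
      next
        case prems: (2 \<beta> \<gamma> \<delta> \<mu>)
        note eq = conjunct1[OF prems] and sgn = spec[OF conjunct2[OF prems]]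
        note crit = relaxed_multiplier_critical[OF f_convex g_convex \<open>0 < t\<close> u eq sgn]
        have zero: "\<beta> = 0" "\<gamma> = 0"
          using W crit(2) by (auto simp: W_def)
        \<comment> \<open>The linear equation for index \<open>i\<close> reduces to this once
          \<beta> and \<delta> are zero.\<close>
        moreover have "\<mu> $ i = 0" for i
          using sgn[of i] zero crit(1) by simp
        then have "\<mu> = 0"
          by (simp add: vec_eq_iff)
        moreover note crit(1)
        ultimately show ?case
          by simp
      qed
    qed
  qed
qed

end
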